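(* Let $G=(V,E)$ be a graph, $w\in V$ a vertex, and $K\subseteq N(w)$ a clique. The inequality $$y\bigl(\delta(w,C_G(K\cup\{w\}))\bigr)+2\,y\bigl(\delta(w,K)\bigr)\le 2x_w$$ defines a facet of $\mathcal{P}(G)$ if and only if no connected component of $\overline{G}[C_G(K\cup\{w\})]$ is bipartite.
   Context: All graphs are finite and simple. $\overline{G}$ is the complement graph of $G$ and $\overline{G}[U]$ its subgraph induced by $U$. A clique is a set of pairwise adjacent vertices (the empty set is allowed). A graph is bipartite if its vertex set can be partitioned into two (possibly empty) stable sets; in particular a one-vertex graph is bipartite. $N(w)$ is the set of neighbors of $w$ in $G$. For $U\subseteq V$, $C_G(U)$ is the set of vertices not in $U$ adjacent in $G$ to every vertex of $U$. For $w\in V$ and $U\subseteq V$, $\delta(w,U)$ is the set of edges of $G$ joining $w$ to a vertex of $U$, and $y(F)=\sum_{e\in F}y_e$ for $F\subseteq E$. $\mathcal{C}_P(G)$ is the cone of all $(x,y)\in\mathbb{R}^V\times\mathbb{R}^E$ satisfying $$y\bigl(\delta(w,C_G(K\cup\{w\}))\bigr)+2\,y\bigl(\delta(w,K)\bigr)\le 2x_w\quad\forall w\in V,\ \text{cliques }K\subseteq N(w);$$ $$x_w\ge 0\quad\forall w\in V;\qquad y_e\ge 0\quad\forall e\in E.$$ $\mathcal{P}(G)$ is the intersection of $\mathcal{C}_P(G)$ with the hyperplane $\{(x,y):\sum_{v\in V}x_v-\sum_{e\in E}y_e=1\}$. The dimension of a polyhedron is the maximum number of affinely independent points in it minus one (so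 the empty set has dimension $-1$). A valid inequality $a^\top z\le\alpha$ for a polyhedron $\mathcal{Q}$ defines a facet of $\mathcal{Q}$ if $\dim(\mathcal{Q}\cap\{z: a^\top z=\alpha\})=\dim\mathcal{Q}-1$. *)

theory Defs
  imports "HOL-Analysis.Analysis"
begin

text \<open>A finite simple graph with vertex set \<open>V\<close> is given by its set \<open>E\<close> of edges, each edge being the
  set of its two ends. The vertex set of the ambient graph is the universe of a finite type.\<close>

definition simple_graph :: "'v set set \<Rightarrow> bool" where
  "simple_graph E \<longleftrightarrow> (\<forall>e\<in>E. card e = 2)"

definition neighbors :: "'v set set \<Rightarrow> 'v \<Rightarrow> 'v set" where
  "neighbors E w = {v. {w, v} \<in> E}"

definition clique :: "'v set set \<Rightarrow> 'v set \<Rightarrow> bool" where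
  "clique E K \<longleftrightarrow> (\<forall>u\<in>K. \<forall>v\<in>K. u \<noteq> v \<longrightarrow> {u, v} \<in> E)"

definition common_nbrs :: "'v set set \<Rightarrow> 'v set \<Rightarrow> 'v set" where
  "common_nbrs E U = {v. v \<notin> U \<and> (\<forall>u\<in>U. {u, v} \<in> E)}"

definition edges_to :: "'v set set \<Rightarrow> 'v \<Rightarrow> 'v set \<Rightarrow> 'v set set" where
  "edges_to E w U = {e \<in> E. \<exists>u\<in>U. e = {w, u}}"

definition complement_edges :: "'v set set \<Rightarrow> 'v set set" where
  "complement_edges E = {e. card e = 2 \<and> e \<notin> E}"

definition induced_edges :: "'v set set \<Rightarrow> 'v set \<Rightarrow> 'v set set" where
  "induced_edges E U = {e \<in> E. e \<subseteq> U}"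

text \<open>In the following notions a graph has an explicit vertex set \<open>W\<close> and edge set \<open>F\<close>. A connected
  component is represented by its vertex set; as a graph it is the induced subgraph.\<close>

definition connected_components :: "'v set \<Rightarrow> 'v set set \<Rightarrow> 'v set set" where
  "connected_components W F = {{v \<in> W. (u, v) \<in> {(a, b). {a, b} \<in> F}\<^sup>*} | u. u \<in> W}"

definition stable_set :: "'v set set \<Rightarrow> 'v set \<Rightarrow> bool" where
  "stable_set F S \<longleftrightarrow> (\<forall>u\<in>S. \<forall>v\<in>S. {u, v} \<notin> F)"

definition bipartite :: "'v set \<Rightarrow> 'v set set \<Rightarrow> bool" where
  "bipartite W F \<longleftrightarrow> (\<exists>A B. A \<union> B = W \<and> A \<inter> B = {} \<and> stable_set F A \<and> stable_set F B)"

text \<open>The space \<open>\<real>\<^sup>V \<times> \<real>\<^sup>E\<close> is identified with the subspace of pairs \<open>(x, y)\<close> in which \<open>y\<close>, indexed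
  by all sets of vertices, vanishes outside \<open>E\<close>: since \<open>E\<close> is a term and may be empty, it cannot
  itself serve as the index type. Dimensions of subsets are unaffected.\<close>

definition cone_P :: "'v::finite set set \<Rightarrow> ((real ^ 'v) \<times> (real ^ 'v set)) set" where
  "cone_P E = {(x, y).
     (\<forall>e. e \<notin> E \<longrightarrow> y $ e = 0) \<and>
     (\<forall>w K. clique E K \<and> K \<subseteq> neighbors E w \<longrightarrow>
        (\<Sum>e \<in> edges_to E w (common_nbrs E (K \<union> {w})). y $ e)
          + 2 * (\<Sum>e \<in> edges_to E w K. y $ e) \<le> 2 * x $ w) \<and>
     (\<forall>w. x $ w \<ge> 0) \<and>
     (\<forall>e\<in>E. y $ e \<ge> 0)}"

definition polyhedron_P :: "'v::finite set set \<Rightarrow> ((real ^ 'v) \<times> (real ^ 'v set)) set" where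
  "polyhedron_P E = cone_P E \<inter> {(x, y). (\<Sum>v\<in>UNIV. x $ v) - (\<Sum>e\<in>E. y $ e) = 1}"

text \<open>The inequality \<open>a\<^sup>T z \<le> \<alpha>\<close> is given by the linear functional \<open>f z = a\<^sup>T z\<close>. This differs from
  the library's \<open>facet_of\<close>, which excludes the empty face: a valid inequality with empty face
  defines a facet of a polyhedron of dimension 0.\<close>

definition defines_facet :: "('n::euclidean_space \<Rightarrow> real) \<Rightarrow> real \<Rightarrow> 'n set \<Rightarrow> bool" where
  "defines_facet f \<alpha> Q \<longleftrightarrow> linear f \<and> (\<forall>z\<in>Q. f z \<le> \<alpha>) \<and>
     aff_dim (Q \<inter> {z. f z = \<alpha>}) = aff_dim Q - 1"

end

theory Submission
  imports Defs
begin

text \<open>The polyhedron lies in a hyperplane avoiding the origin, so affine dimension is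
  linear dimension minus one. The face contains the points given by single vertices \<open>v \<noteq> w\<close> and by
  suitable edges and induced paths on three vertices; modulo these and the vertex \<open>w\<close>, the unit
  vectors of the edges \<open>wu\<close> and \<open>wv\<close> are negatives of each other whenever \<open>uv\<close> is an edge of the
  complement inside \<open>U = C\<^sub>G(K \<union> {w})\<close>. Along an odd closed walk this puts the unit vectors
  themselves into the span, so the face has codimension one. Conversely, a bipartite component with
  parts \<open>A\<close> and \<open>B\<close> makes \<open>K \<union> A\<close> and \<open>K \<union> B\<close> cliques, whose inequalities force
  \<open>y(\<delta>(w,A)) = y(\<delta>(w,B))\<close> on the face.\<close>

text \<open>For a neighbor \<open>u\<close> of \<open>w\<close>, the coefficient of
  \<open>y $ {w, u}\<close> on the left-hand side of the inequality of \<open>w\<close> and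
  \<open>K\<close>.\<close>

definition coef :: "'v set set \<Rightarrow> 'v \<Rightarrow> 'v set \<Rightarrow> 'v \<Rightarrow> real" where
  "coef E w K u = of_bool (u \<in> common_nbrs E (K \<union> {w})) + 2 * of_bool (u \<in> K)"

text \<open>For \<open>a = b\<close> this is a single edge with its two ends.\<close>
definition path_point ::
  "'v \<Rightarrow> 'v \<Rightarrow> 'v \<Rightarrow> (real ^ 'v::finite) \<times> (real ^ 'v set)" where
  "path_point c a b = ((\<chi> v. of_bool (v \<in> {a, b, c})), (\<chi> e. of_bool (e \<in> {{c, a}, {c, b}})))"

text \<open>The affine hull misses 0, so adjoining 0 raises the affine dimension by exactly one and
  makes it the linear dimension. The empty set is covered, with dimension -1.\<close>

lemma aff_dim_hyperplane_away_from_0: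
  fixes S :: "'a::euclidean_space set"
  assumes "linear h" "\<And>z. z \<in> S \<Longrightarrow> h z = (1::real)"
  shows "aff_dim S = int (dim S) - 1"
proof -
  have "affine {z. h z = 1}"
    using assms(1) unfolding affine_def
    by (auto simp: linear_add linear_cmul)
  then have "affine hull S \<subseteq> {z. h z = 1}"
    using assms(2) by (intro hull_minimal) auto
  then have "0 \<notin> affine hull S"
    using linear_0[OF assms(1)] by auto
  then have "aff_dim (insert 0 S) = aff_dim S + 1"
    by (simp add: aff_dim_insert)
  moreover have "aff_dim (insert 0 S) = int (dim (insert 0 S))"
    by (rule aff_dim_zero) (simp add: hull_inc)
  ultimately show ?thesis by (simp add: dim_insert span_zero)
qed

section \<open>Edges at a vertex and the clique inequality\<close>

lemma simple_graph_edge_neq: "simple_graph E \<Longrightarrow> {a, b} \<in> E \<Longrightarrow> a \<noteq> b"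
  unfolding simple_graph_def by (metis card_2_iff doubleton_eq_iff insert_absorb2)

lemma simple_graph_edgeE:
  assumes "simple_graph E" "e \<in> E"
  obtains a b where "e = {a, b}" "a \<noteq> b"
  using assms unfolding simple_graph_def by (metis card_2_iff)

lemma common_nbrs_subset: "common_nbrs E (K \<union> {w}) \<subseteq> neighbors E w"
  by (auto simp: common_nbrs_def neighbors_def)

lemma common_nbrs_disjoint: "common_nbrs E (K \<union> {w}) \<inter> K = {}"
  by (auto simp: common_nbrs_def)

lemma sum_edges_to:
  fixes E :: "'v::finite set set"
  assumes "U \<subseteq> neighbors E w"
  shows "(\<Sum>e\<in>edges_to E w U. f e) = (\<Sum>u\<in>U. f {w, u})"
proof -
  have "edges_to E w U = (\<lambda>u. {w, u}) ` U"
    using assms by (auto simp: edges_to_def neighbors_def)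
  moreover have "inj_on (\<lambda>u. {w, u}) U"
    by (auto simp: inj_on_def doubleton_eq_iff)
  ultimately show ?thesis by (simp add: sum.reindex)
qed

text \<open>With one index set for every clique, the inequalities of different cliques at
  \<open>w\<close> can be compared term by term.\<close>

lemma clique_sum_eq:
  fixes E :: "'v::finite set set" and y :: "real ^ 'v set"
  assumes "K \<subseteq> neighbors E w"
  shows "(\<Sum>e \<in> edges_to E w (common_nbrs E (K \<union> {w})). y $ e) + 2 * (\<Sum>e \<in> edges_to E w K. y $ e)
    = (\<Sum>u\<in>neighbors E w. coef E w K u * y $ {w, u})"
proof -
  have *: "(\<Sum>u\<in>U. y $ {w, u}) = (\<Sum>u\<in>neighbors E w. of_bool (u \<in> U) * y $ {w, u})"
    if "U \<subseteq> neighbors E w" for U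
    using that by (intro sum.mono_neutral_cong_left) auto
  show ?thesis
    unfolding sum_edges_to[OF assms] sum_edges_to[OF common_nbrs_subset]
      *[OF assms] *[OF common_nbrs_subset] coef_def
    by (simp only: sum.distrib sum_distrib_left distrib_right mult.assoc)
qed

lemma mem_cone_P_iff:
  fixes E :: "'v::finite set set"
  shows "z \<in> cone_P E \<longleftrightarrow>
     (\<forall>e. e \<notin> E \<longrightarrow> snd z $ e = 0) \<and>
     (\<forall>w K. clique E K \<and> K \<subseteq> neighbors E w \<longrightarrow>
        (\<Sum>u\<in>neighbors E w. coef E w K u * snd z $ {w, u}) \<le> 2 * fst z $ w) \<and>
     (\<forall>w. fst z $ w \<ge> 0) \<and> (\<forall>e\<in>E. snd z $ e \<ge> 0)"
proof -
  have "(clique E K \<and> K \<subseteq> neighbors E w \<longrightarrow>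
        (\<Sum>e \<in> edges_to E w (common_nbrs E (K \<union> {w})). snd z $ e)
          + 2 * (\<Sum>e \<in> edges_to E w K. snd z $ e) \<le> 2 * fst z $ w) \<longleftrightarrow>
      (clique E K \<and> K \<subseteq> neighbors E w \<longrightarrow>
        (\<Sum>u\<in>neighbors E w. coef E w K u * snd z $ {w, u}) \<le> 2 * fst z $ w)" for w K
    by (cases "K \<subseteq> neighbors E w") (simp_all only: clique_sum_eq simp_thms)
  then show ?thesis unfolding cone_P_def case_prod_beta by simp
qed

section \<open>Points of the polyhedron from single edges and induced paths\<close>

lemma coef_le_2: "coef E w K u \<le> 2"
  using common_nbrs_disjoint[of E K w] by (auto simp: coef_def of_bool_def)

text \<open>This includes the case \<open>a = b\<close>, as \<open>{a}\<close> is not an edge.\<close>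
lemma sum_coef_nonadjacent_le_2:
  assumes "clique E K" "{a, b} \<notin> E"
  shows "(\<Sum>u\<in>{a, b}. coef E w K u) \<le> 2"
proof (cases "a = b")
  case True
  then show ?thesis by (simp add: coef_le_2)
next
  case False
  have "\<not> (a \<in> K \<and> b \<in> K)"
    using assms False by (auto simp: clique_def)
  moreover have "a \<in> K \<Longrightarrow> b \<notin> common_nbrs E (K \<union> {w})" "b \<in> K \<Longrightarrow> a \<notin> common_nbrs E (K \<union> {w})"
    using assms by (auto simp: common_nbrs_def insert_commute)
  ultimately show ?thesis
    using False common_nbrs_disjoint[of E K w] by (auto simp: coef_def of_bool_def)
qed

text \<open>The center \<open>c\<close> sees both ends, an end sees only \<open>c\<close>, and any
  other vertex sees nothing. Summing over the set \<open>{a, b}\<close> counts a single edge once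
  when \<open>a = b\<close>.\<close>

lemma sum_coef_path_point:
  fixes E :: "'v::finite set set"
  assumes "simple_graph E" "{c, a} \<in> E" "{c, b} \<in> E"
  shows "(\<Sum>u\<in>neighbors E v. g u * snd (path_point c a b) $ {v, u})
    = (if v = c then \<Sum>u\<in>{a, b}. g u else if v \<in> {a, b} then g c else 0)"
proof -
  have ne: "c \<noteq> a" "c \<noteq> b"
    using assms simple_graph_edge_neq by metis+
  consider "v = c" | "v \<noteq> c" "v \<in> {a, b}" | "v \<noteq> c" "v \<notin> {a, b}" by blast
  then show ?thesis
  proof cases
    case 1
    have "(\<Sum>u\<in>neighbors E v. g u * snd (path_point c a b) $ {v, u}) = (\<Sum>u\<in>{a, b}. g u)"
      using assms 1
      by (intro sum.mono_neutral_cong_right)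
        (auto simp: path_point_def neighbors_def doubleton_eq_iff)
    then show ?thesis using 1 by simp
  next
    case 2
    have "(\<Sum>u\<in>neighbors E v. g u * snd (path_point c a b) $ {v, u}) = (\<Sum>u\<in>{c}. g u)"
      using assms 2
      by (intro sum.mono_neutral_cong_right)
        (auto simp: path_point_def neighbors_def doubleton_eq_iff insert_commute)
    then show ?thesis using 2 by simp
  next
    case 3
    then show ?thesis
      by (auto simp: path_point_def doubleton_eq_iff intro!: sum.neutral)
  qed
qed

text \<open>At \<open>c\<close> the coefficients of the nonadjacent ends add up to at most 2; at an
  end only the coefficient of \<open>c\<close> counts, again at most 2.\<close>

lemma path_point_in_P:
  fixes E :: "'v::finite set set"
  assumes E: "simple_graph E" and e: "{c, a} \<in> E" "{c, b} \<in> E" "{a, b} \<notin> E"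
  shows "path_point c a b \<in> polyhedron_P E"
proof -
  let ?x = "fst (path_point c a b)" and ?y = "snd (path_point c a b)"
  have ne: "c \<noteq> a" "c \<noteq> b"
    using E e simple_graph_edge_neq by metis+
  have nonneg: "0 \<le> ?x $ v" "0 \<le> ?y $ f" and supp: "f \<notin> E \<Longrightarrow> ?y $ f = 0" for v f
    using e by (auto simp: path_point_def)
  have "(\<Sum>u\<in>neighbors E v. coef E v K u * ?y $ {v, u}) \<le> 2 * ?x $ v"
    if "clique E K" for v K
    using sum_coef_nonadjacent_le_2[OF that e(3)] coef_le_2[of E v K]
    unfolding sum_coef_path_point[OF E e(1,2)]
    by (auto simp: path_point_def)
  moreover have "(\<Sum>v\<in>UNIV. ?x $ v) = real (card {a, b, c})"
  proof -
    have "(\<Sum>v\<in>UNIV. ?x $ v) = (\<Sum>v\<in>{a, b, c}. 1)"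
      by (intro sum.mono_neutral_cong_right) (auto simp: path_point_def)
    then show ?thesis by simp
  qed
  moreover have "(\<Sum>f\<in>E. ?y $ f) = real (card {{c, a}, {c, b}})"
  proof -
    have "(\<Sum>f\<in>E. ?y $ f) = (\<Sum>f\<in>{{c, a}, {c, b}}. 1)"
      using e by (intro sum.mono_neutral_cong_right) (auto simp: path_point_def)
    then show ?thesis by simp
  qed
  \<comment> \<open>A path has one vertex more than edges: 3 and 2, or 2 and 1 if
    \<open>a = b\<close>.\<close>
  moreover have "real (card {a, b, c}) - real (card {{c, a}, {c, b}}) = 1"
    using ne by (cases "a = b") (auto simp: doubleton_eq_iff card_insert_if)
  ultimately show ?thesis
    using nonneg supp unfolding polyhedron_P_def by (simp add: mem_cone_P_iff case_prod_beta)
qed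

lemma vertex_in_P: "(axis v 1, 0) \<in> polyhedron_P E"
  unfolding polyhedron_P_def cone_P_def by (auto simp: axis_def)

section \<open>Spanning arguments\<close>

lemma snd_path_point_neq:
  assumes "a \<noteq> b"
  shows "snd (path_point c a b) = axis {c, a} 1 + axis {c, b} 1"
  using assms by (auto simp: path_point_def axis_def vec_eq_iff doubleton_eq_iff)

lemma snd_path_point_same: "snd (path_point c a a) = axis {c, a} 1"
  by (auto simp: path_point_def axis_def vec_eq_iff)

text \<open>Propagates \<open>e u = \<plusminus> e r\<close> modulo \<open>S\<close> along a component; without a bipartition some vertex gets
  both signs.\<close>
lemma nonbipartite_component_in_subspace:
  fixes e :: "'v \<Rightarrow> 'b::real_vector"
  assumes S: "subspace S"
    and edge: "\<And>u v. {u, v} \<in> F \<Longrightarrow> e u + e v \<in> S"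
    and r: "r \<in> W"
    and nb: "\<And>C. C \<in> connected_components W F \<Longrightarrow> \<not> bipartite C (F \<inter> Pow C)"
  shows "e r \<in> S"
proof -
  define C where "C = {v \<in> W. (r, v) \<in> {(a, b). {a, b} \<in> F}\<^sup>*}"
  \<comment> \<open>\<open>A\<close> and \<open>B\<close> collect the vertices of the component
    whose vector is \<open>e r\<close> or \<open>- e r\<close> modulo \<open>S\<close>.\<close>
  define A where "A = {v \<in> C. e v - e r \<in> S}"
  define B where "B = {v \<in> C. e v + e r \<in> S}"
  have sign: "e v - e r \<in> S \<or> e v + e r \<in> S" if "(r, v) \<in> {(a, b). {a, b} \<in> F}\<^sup>*" for v
    using that
  proof (induction rule: rtrancl_induct)
    case base
    show ?case using subspace_0[OF S] by simp
  next
    case (step u v)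
    then have uv: "e u + e v \<in> S" using edge by simp
    from step.IH show ?case
      using subspace_diff[OF S uv, of "e u - e r"] subspace_diff[OF S uv, of "e u + e r"]
      by (auto simp: algebra_simps)
  qed
  have AB: "A \<union> B = C"
    using sign by (auto simp: A_def B_def C_def)
  have double: "e r \<in> S" if "e r + e r \<in> S"
    using subspace_scale[OF S that, of "1/2"] by (simp flip: scaleR_2)
  have "C \<in> connected_components W F"
    using r by (auto simp: connected_components_def C_def)
  then have "\<not> bipartite C (F \<inter> Pow C)" by (rule nb)
  then have "\<not> (A \<inter> B = {} \<and> stable_set (F \<inter> Pow C) A \<and> stable_set (F \<inter> Pow C) B)"
    using AB by (auto simp only: bipartite_def)
  \<comment> \<open>\<open>A\<close> and \<open>B\<close> cover \<open>C\<close>, so they overlap or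
    one of them contains an edge; each case puts \<open>e r + e r\<close> into
    \<open>S\<close>.\<close>
  then consider v where "v \<in> A \<inter> B"
    | u v where "u \<in> A" "v \<in> A" "{u, v} \<in> F" | u v where "u \<in> B" "v \<in> B" "{u, v} \<in> F"
    unfolding stable_set_def by blast
  then show ?thesis
  proof cases
    case 1
    then have "e v + e r \<in> S" "e v - e r \<in> S"
      by (simp_all add: A_def B_def)
    from subspace_diff[OF S this] show ?thesis
      by (intro double) (simp add: algebra_simps)
  next
    case 2
    then have "e u + e v \<in> S" "(e u - e r) + (e v - e r) \<in> S"
      using subspace_add[OF S] edge unfolding A_def by blast+
    from subspace_diff[OF S this] show ?thesis
      by (intro double) (simp add: algebra_simps)
  next
    case 3
    then have "(e u + e r) + (e v + e r) \<in> S" "e u + e v \<in> S"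
      using subspace_add[OF S] edge unfolding B_def by blast+
    from subspace_diff[OF S this] show ?thesis
      by (intro double) (simp add: algebra_simps)
  qed
qed

text \<open>Expansion in the standard basis, where sets outside \<open>E\<close> contribute zero.
  Taking \<open>{}\<close> for \<open>E\<close> gives all points with vanishing edge part.\<close>

lemma subspace_contains_supported:
  fixes S :: "((real ^ 'v::finite) \<times> (real ^ 'v set)) set"
  assumes S: "subspace S"
    and vx: "\<And>v. (axis v 1, 0) \<in> S"
    and ed: "\<And>e. e \<in> E \<Longrightarrow> (0, axis e 1) \<in> S"
    and y: "\<And>e. e \<notin> E \<Longrightarrow> snd z $ e = 0"
  shows "z \<in> S"
proof -
  have expand: "a = (\<Sum>i\<in>UNIV. a $ i *\<^sub>R axis i 1)" for a :: "real ^ 'n::finite"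
    using basis_expansion[of a] by (simp add: scalar_mult_eq_scaleR)
  have "z = (\<Sum>v\<in>UNIV. fst z $ v *\<^sub>R (axis v 1, 0)) + (\<Sum>e\<in>UNIV. snd z $ e *\<^sub>R (0, axis e 1))"
    using expand[of "fst z"] expand[of "snd z"]
    by (simp add: prod_eq_iff fst_sum snd_sum)
  also have "\<dots> \<in> S"
  proof (intro subspace_add[OF S] subspace_sum[OF S])
    show "snd z $ e *\<^sub>R (0, axis e 1) \<in> S" for e
      using subspace_scale[OF S ed] y subspace_0[OF S]
        by (cases "e \<in> E") (auto simp: zero_prod_def)
  qed (use subspace_scale[OF S vx] in blast)
  finally show ?thesis .
qed

section \<open>Balance between the two sides of a bipartite component\<close>

lemma component_not_adjacent:
  assumes "C \<in> connected_components U F" "u \<in> C" "v \<in> U - C"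
  shows "{u, v} \<notin> F"
proof
  assume "{u, v} \<in> F"
  moreover obtain r where "C = {v \<in> U. (r, v) \<in> {(a, b). {a, b} \<in> F}\<^sup>*}"
    using assms(1) by (auto simp: connected_components_def)
  ultimately have "v \<in> C"
    using assms(2,3) by (auto intro: rtrancl_into_rtrancl)
  then show False using assms(3) by simp
qed

text \<open>\<open>K \<union> A\<close> is again a clique in \<open>N(w)\<close>. Compared with
  \<open>K\<close>, its inequality gains \<open>y\<close> on \<open>A\<close> and loses at most
  \<open>y\<close> on \<open>B\<close>; as \<open>K\<close> is tight, the gain cannot exceed the
  loss. Exchanging \<open>A\<close> and \<open>B\<close> gives the reverse bound.\<close>

lemma bipartite_part_balance:
  fixes E :: "'v::finite set set" and y :: "real ^ 'v set"
  assumes E: "simple_graph E" and K: "K \<subseteq> neighbors E w" "clique E K"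
    and U: "U = common_nbrs E (K \<union> {w})"
    and AB: "A \<subseteq> U" "B \<subseteq> U" "A \<inter> B = {}"
    and A: "\<And>a b. a \<in> A \<Longrightarrow> b \<in> A \<Longrightarrow> a \<noteq> b \<Longrightarrow> {a, b} \<in> E"
    and sep: "\<And>a v. a \<in> A \<Longrightarrow> v \<in> U - (A \<union> B) \<Longrightarrow> {a, v} \<in> E"
    and z: "(x, y) \<in> cone_P E"
    and tight: "(\<Sum>u\<in>neighbors E w. coef E w K u * y $ {w, u}) = 2 * x $ w"
  shows "(\<Sum>u\<in>A. y $ {w, u}) \<le> (\<Sum>u\<in>B. y $ {w, u})"
proof -
  let ?N = "neighbors E w"
  have UN: "U \<subseteq> ?N" using common_nbrs_subset U by simp
  have KU: "K \<inter> U = {}" using common_nbrs_disjoint[of E K w] U by auto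
  have cl: "clique E (K \<union> A)"
  proof -
    have KA: "{k, a} \<in> E" "{a, k} \<in> E" if "k \<in> K" "a \<in> A" for k a
      using that AB(1) unfolding U common_nbrs_def by (auto simp: insert_commute)
    show ?thesis
      using K(2) A KA unfolding clique_def by blast
  qed
  have sub: "K \<union> A \<subseteq> ?N" using K(1) AB(1) UN by blast
  have "(\<Sum>u\<in>?N. coef E w (K \<union> A) u * y $ {w, u}) \<le> 2 * x $ w"
    using z cl sub unfolding mem_cone_P_iff by simp
  then have "0 \<le> (\<Sum>u\<in>?N. (coef E w K u - coef E w (K \<union> A) u) * y $ {w, u})"
    using tight by (simp add: left_diff_distrib sum_subtractf)
  \<comment> \<open>The coefficient goes from 1 to 2 on \<open>A\<close>, drops by at most 1 on
    \<open>B\<close>, and does not drop elsewhere: by \<open>sep\<close>, the rest of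
    \<open>U\<close> remains adjacent to all of \<open>K \<union> A\<close>.\<close>
  also have "\<dots> \<le> (\<Sum>u\<in>?N. (of_bool (u \<in> B) - of_bool (u \<in> A)) * y $ {w, u})"
  proof (intro sum_mono mult_right_mono)
    fix u assume u: "u \<in> ?N"
    show "0 \<le> y $ {w, u}" using u z by (auto simp: cone_P_def neighbors_def)
    have "u \<in> common_nbrs E (K \<union> A \<union> {w})" if "u \<in> U - (A \<union> B)"
      using that sep u U unfolding common_nbrs_def by auto
    then show "coef E w K u - coef E w (K \<union> A) u \<le> of_bool (u \<in> B) - of_bool (u \<in> A)"
      using AB KU unfolding coef_def U[symmetric] by (auto simp: of_bool_def)
  qed
  also have "\<dots> = (\<Sum>u\<in>B. y $ {w, u}) - (\<Sum>u\<in>A. y $ {w, u})"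
  proof -
    have *: "(\<Sum>u\<in>?N. of_bool (u \<in> X) * y $ {w, u}) = (\<Sum>u\<in>X. y $ {w, u})" if "X \<subseteq> U" for X
      using that UN by (intro sum.mono_neutral_cong_right) auto
    show ?thesis
      by (simp add: left_diff_distrib sum_subtractf *[OF AB(1)] *[OF AB(2)])
  qed
  finally show ?thesis by simp
qed

lemma notin_span_of_linear_zero:
  assumes "linear f" "\<And>z. z \<in> S \<Longrightarrow> f z = 0" "f p \<noteq> (0::real)"
  shows "p \<notin> span S"
  using linear_eq_0_on_span[OF assms(1,2)] assms(3) by blast

section \<open>The facet criterion\<close>

theorem theorem2p14:
  fixes E :: "'v::finite set set" and w :: 'v and K :: "'v set"
  assumes "simple_graph E"
    and "K \<subseteq> neighbors E w"
    and "clique E K"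
  shows "defines_facet
           (\<lambda>(x :: real ^ 'v, y :: real ^ 'v set).
              (\<Sum>e \<in> edges_to E w (common_nbrs E (K \<union> {w})). y $ e)
                + 2 * (\<Sum>e \<in> edges_to E w K. y $ e) - 2 * x $ w)
           0 (polyhedron_P E)
         \<longleftrightarrow>
         (let U = common_nbrs E (K \<union> {w}); F = induced_edges (complement_edges E) U
          in \<not> (\<exists>C \<in> connected_components U F. bipartite C (induced_edges F C)))"
proof -
  define f where "f = (\<lambda>z :: (real ^ 'v) \<times> (real ^ 'v set).
    (\<Sum>u\<in>neighbors E w. coef E w K u * snd z $ {w, u}) - 2 * fst z $ w)"
  define U where "U = common_nbrs E (K \<union> {w})"
  define F where "F = induced_edges (complement_edges E) U"
  define P where "P = polyhedron_P E"
  define Fa where "Fa = P \<inter> {z. f z = 0}"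
  define p0 :: "(real ^ 'v) \<times> (real ^ 'v set)" where "p0 = (axis w 1, 0)"
  have f_eq: "(\<lambda>(x :: real ^ 'v, y :: real ^ 'v set).
              (\<Sum>e \<in> edges_to E w (common_nbrs E (K \<union> {w})). y $ e)
                + 2 * (\<Sum>e \<in> edges_to E w K. y $ e) - 2 * x $ w) = f"
    unfolding f_def clique_sum_eq[OF assms(2)] by (auto simp: fun_eq_iff)
  have lin: "linear f"
    unfolding f_def
    by (rule linearI) (simp_all add: sum.distrib sum_distrib_left algebra_simps)
  have valid: "f z \<le> 0" if "z \<in> P" for z
    using that assms(2,3) by (simp add: P_def polyhedron_P_def mem_cone_P_iff f_def)
  have aff: "aff_dim S = int (dim S) - 1" if "S \<subseteq> P" for S
  proof (rule aff_dim_hyperplane_away_from_0)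
    show "linear (\<lambda>z :: (real ^ 'v) \<times> (real ^ 'v set). (\<Sum>v\<in>UNIV. fst z $ v) - (\<Sum>e\<in>E. snd z $ e))"
      by (rule linearI) (simp_all add: sum.distrib sum_distrib_left algebra_simps)
  qed (use that in \<open>auto simp: P_def polyhedron_P_def\<close>)
  have facet_iff: "defines_facet f 0 P \<longleftrightarrow> dim P = Suc (dim Fa)"
  proof -
    have "aff_dim P = int (dim P) - 1" "aff_dim Fa = int (dim Fa) - 1"
      by (auto intro!: aff simp: Fa_def)
    then show ?thesis
      using lin valid by (auto simp: defines_facet_def Fa_def[symmetric])
  qed
  have p0: "p0 \<in> P" "f p0 = -2"
    unfolding P_def p0_def by (rule vertex_in_P) (simp add: f_def)
  \<comment> \<open>\<open>f\<close> vanishes on the face but not at \<open>p0\<close>, so the face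
    always has codimension at least one.\<close>
  have p0_notin: "p0 \<notin> span Fa"
    using lin p0 by (intro notin_span_of_linear_zero[of f]) (auto simp: Fa_def)
  \<comment> \<open>Such a point is tight if its center is \<open>w\<close> and the coefficients of
    its ends sum to 2, or if it avoids \<open>w\<close>.\<close>
  have f_path: "f (path_point c a b) =
      (if w = c then (\<Sum>u\<in>{a, b}. coef E w K u) - 2 else if w \<in> {a, b} then coef E w K c - 2 else 0)"
    if "{c, a} \<in> E" "{c, b} \<in> E" for a b c
    unfolding f_def sum_coef_path_point[OF assms(1) that] by (auto simp: path_point_def)
  have UN: "U \<subseteq> neighbors E w" using common_nbrs_subset U_def by metis
  have KU: "K \<inter> U = {}" using common_nbrs_disjoint[of E K w] U_def by auto
  have coef_U: "coef E w K u = of_bool (u \<in> U) + 2 * of_bool (u \<in> K)" for u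
    by (simp only: coef_def U_def)
  have single: "{a} \<notin> E" for a
    using assms(1) by (auto simp: simple_graph_def)

  \<comment> \<open>Sufficiency: the face and \<open>p0\<close> span the polyhedron\<close>
  have "dim P = Suc (dim Fa)"
    if nb: "\<And>C. C \<in> connected_components U F \<Longrightarrow> \<not> bipartite C (induced_edges F C)"
  proof -
    define S where "S = span (insert p0 Fa)"
    have S: "subspace S" by (simp add: S_def)
    have FaS: "z \<in> S" if "z \<in> P" "f z = 0" for z
      using that by (auto simp: S_def Fa_def intro: span_base)
    have vx: "(axis v 1, 0) \<in> S" for v
    proof (cases "v = w")
      case True
      then show ?thesis by (auto simp: S_def p0_def intro: span_base)
    next
      case False
      then show ?thesis
        using vertex_in_P by (intro FaS) (auto simp: P_def f_def axis_def)
    qed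
    \<comment> \<open>Vertex parts can now be subtracted freely, so only edge parts matter.\<close>
    have vxs: "(x, 0) \<in> S" for x
      by (rule subspace_contains_supported[OF S vx, of "{}"]) auto
    have path: "(0, snd (path_point c a b)) \<in> S"
      if "{c, a} \<in> E" "{c, b} \<in> E" "{a, b} \<notin> E" "f (path_point c a b) = 0" for a b c
    proof -
      have "path_point c a b \<in> S"
        using that path_point_in_P[OF assms(1)] by (intro FaS) (auto simp: P_def)
      from subspace_diff[OF S this vxs[of "fst (path_point c a b)"]]
      show ?thesis by (cases "path_point c a b") simp
    qed
    define e where "e u = (0 :: real ^ 'v, axis {w, u} (1::real))" for u
    have eK: "e k \<in> S" if "k \<in> K" for k
    proof -
      have "{w, k} \<in> E" using that assms(2) by (auto simp: neighbors_def)
      moreover have "coef E w K k = 2"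
        using that KU by (auto simp: coef_U)
      ultimately show ?thesis
        using path[of w k k] single by (simp add: f_path snd_path_point_same e_def)
    qed
    have eU: "e r \<in> S" if "r \<in> U" for r
    proof (rule nonbipartite_component_in_subspace[OF S _ that, of F])
      show "e u + e v \<in> S" if uv: "{u, v} \<in> F" for u v
      proof -
        have *: "u \<in> U" "v \<in> U" "{u, v} \<notin> E" "u \<noteq> v"
          using uv by (auto simp: F_def induced_edges_def complement_edges_def)
        then have "{w, u} \<in> E" "{w, v} \<in> E" using UN by (auto simp: neighbors_def)
        \<comment> \<open>The induced path \<open>u\<close>, \<open>w\<close>, \<open>v\<close> is
          tight because 1 + 1 = 2.\<close>
        moreover have "coef E w K u = 1" "coef E w K v = 1"
          using * KU by (auto simp: coef_U)
        ultimately show ?thesis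
          using path[of w u v] * by (simp add: f_path snd_path_point_neq e_def)
      qed
      show "\<not> bipartite C (F \<inter> Pow C)" if "C \<in> connected_components U F" for C
        using nb[OF that] by (simp add: induced_edges_def Int_def)
    qed
    have eN: "e t \<in> S" if t: "t \<in> neighbors E w" for t
    proof (cases "t \<in> K \<union> U")
      case True
      then show ?thesis using eK eU by auto
    next
      case False
      have wt: "{w, t} \<in> E" using t by (simp add: neighbors_def)
      then have "t \<noteq> w" using single by auto
      \<comment> \<open>As \<open>t\<close> lies in neither \<open>K\<close> nor \<open>U\<close>,
        some \<open>k\<close> in \<open>K\<close> is not adjacent to it. The path \<open>k\<close>,
        \<open>w\<close>, \<open>t\<close> is tight with coefficients 2 and 0, and
        \<open>e k\<close> is already in \<open>S\<close>.\<close>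
      then obtain k where k: "k \<in> K" "{k, t} \<notin> E"
        using False wt by (auto simp: U_def common_nbrs_def)
      have "{w, k} \<in> E" using k assms(2) by (auto simp: neighbors_def)
      moreover have "coef E w K k = 2" "coef E w K t = 0"
        using k False KU by (auto simp: coef_U)
      moreover have "k \<noteq> t" using k False by auto
      ultimately have "e k + e t \<in> S"
        using path[of w k t] wt k by (simp add: f_path snd_path_point_neq e_def)
      from subspace_diff[OF S this eK[OF k(1)]] show ?thesis by simp
    qed
    have ed: "(0, axis g 1) \<in> S" if g: "g \<in> E" for g
    proof (cases "w \<in> g")
      case True
      obtain a b where "g = {a, b}" using simple_graph_edgeE[OF assms(1) g] .
      then obtain t where t: "g = {w, t}" using True by (auto simp: insert_commute)
      then show ?thesis using eN[of t] g by (simp add: neighbors_def e_def)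
    next
      case False
      obtain a b where "g = {a, b}" using simple_graph_edgeE[OF assms(1) g] .
      \<comment> \<open>For an edge avoiding \<open>w\<close>, both sides of the inequality are
        0.\<close>
      then show ?thesis
        using path[of a b b] False g single by (simp add: f_path snd_path_point_same)
    qed
    have "P \<subseteq> S"
      using subspace_contains_supported[OF S vx ed]
      by (auto simp: P_def polyhedron_P_def cone_P_def)
    moreover have "insert p0 Fa \<subseteq> P" using p0 by (auto simp: Fa_def)
    ultimately have "dim P = dim (insert p0 Fa)"
      unfolding S_def by (meson dim_mono dim_subset le_antisym)
    then show ?thesis using p0_notin by (simp add: dim_insert)
  qed

  \<comment> \<open>Necessity: a bipartite component gives a second equation\<close>
  moreover have "dim P \<noteq> Suc (dim Fa)"
    if C: "C \<in> connected_components U F" and bip: "bipartite C (induced_edges F C)" for C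
  proof -
    obtain A B where AB: "A \<union> B = C" "A \<inter> B = {}"
      and st: "stable_set (induced_edges F C) A" "stable_set (induced_edges F C) B"
      using bip by (auto simp: bipartite_def)
    have CU: "C \<subseteq> U" using C by (auto simp: connected_components_def)
    have adj: "{a, b} \<in> E" if "a \<in> U" "b \<in> U" "a \<noteq> b" "{a, b} \<notin> F" for a b
      using that by (auto simp: F_def induced_edges_def complement_edges_def)
    have part: "{a, b} \<in> E" if "stable_set (induced_edges F C) X" "X \<subseteq> C" "a \<in> X" "b \<in> X" "a \<noteq> b"
      for a b X
      using that CU by (intro adj) (auto simp: stable_set_def induced_edges_def)
    have sep: "{a, v} \<in> E" if "a \<in> C" "v \<in> U - C" for a v
      using that component_not_adjacent[OF C that] CU by (intro adj) auto
    \<comment> \<open>A second linear functional vanishing on the face; unlike \<open>f\<close> it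
      also vanishes at \<open>p0\<close>.\<close>
    define g where "g = (\<lambda>z :: (real ^ 'v) \<times> (real ^ 'v set).
      (\<Sum>u\<in>A. snd z $ {w, u}) - (\<Sum>u\<in>B. snd z $ {w, u}))"
    have ling: "linear g"
      unfolding g_def
      by (rule linearI) (simp_all add: sum.distrib sum_distrib_left algebra_simps)
    have g0: "g z = 0" if "z \<in> Fa" for z
    proof -
      have z: "(fst z, snd z) \<in> cone_P E"
        and tight: "(\<Sum>u\<in>neighbors E w. coef E w K u * snd z $ {w, u}) = 2 * fst z $ w"
        using that by (auto simp: Fa_def P_def polyhedron_P_def f_def)
      have "(\<Sum>u\<in>A. snd z $ {w, u}) \<le> (\<Sum>u\<in>B. snd z $ {w, u})"
        using AB CU part[OF st(1)] sep
        by (intro bipartite_part_balance[OF assms U_def _ _ _ _ _ z tight]) auto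
      moreover have "(\<Sum>u\<in>B. snd z $ {w, u}) \<le> (\<Sum>u\<in>A. snd z $ {w, u})"
        using AB CU part[OF st(2)] sep
        by (intro bipartite_part_balance[OF assms U_def _ _ _ _ _ z tight]) auto
      ultimately show ?thesis by (simp add: g_def)
    qed
    obtain u where u: "u \<in> C" using C by (auto simp: connected_components_def)
    \<comment> \<open>The single edge \<open>wu\<close>: since \<open>u\<close> lies in exactly one
      of \<open>A\<close> and \<open>B\<close>, \<open>g\<close> is 1 or -1 there.\<close>
    define p1 where "p1 = path_point w u u"
    have wu: "{w, u} \<in> E" using u CU UN by (auto simp: neighbors_def)
    have p1: "p1 \<in> P" using path_point_in_P[OF assms(1) wu wu] single by (simp add: p1_def P_def)
    have p1y: "snd p1 $ {w, v} = of_bool (v = u)" for v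
      by (auto simp: p1_def path_point_def doubleton_eq_iff)
    have "g p1 = of_bool (u \<in> A) - of_bool (u \<in> B)"
      by (simp add: g_def p1y of_bool_def)
    then have "g p1 \<noteq> 0" using u AB by auto
    moreover have "g p0 = 0" by (simp add: g_def p0_def)
    ultimately have "p1 \<notin> span (insert p0 Fa)"
      using g0 by (intro notin_span_of_linear_zero[OF ling]) auto
    \<comment> \<open>\<open>p0\<close> and \<open>p1\<close> each add a dimension to the span of
      the face, so its codimension is at least two.\<close>
    then have "dim (insert p1 (insert p0 Fa)) = dim Fa + 2"
      using p0_notin by (simp add: dim_insert)
    moreover have "dim (insert p1 (insert p0 Fa)) \<le> dim P"
      using p0 p1 by (intro dim_subset) (auto simp: Fa_def)
    ultimately show ?thesis by linarith
  qed
  ultimately show ?thesis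
    unfolding f_eq Let_def
    unfolding U_def[symmetric] F_def[symmetric] P_def[symmetric] facet_iff
    by metis
qed

end
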